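(* Let $K_1,K_2\subset\mathbb{R}$ be regular Cantor sets of class $C^{1+\alpha}$, $\alpha>0$, such that $d=\mathrm{HD}(K_1)+\mathrm{HD}(K_2)>1$. Then $m\left(\mathrm{proj}_\theta(K_1\times K_2)\right)>0$ for $m$-almost every $\theta\in\mathbb{R}$.
   Context: $\mathrm{HD}$ denotes Hausdorff dimension. $m$ denotes Lebesgue measure on $\mathbb{R}$, and also on any line in $\mathbb{R}^2$ through the origin (identified isometrically with $\mathbb{R}$). For $\theta\in\mathbb{R}$, $v_\theta=(\cos\theta,\sin\theta)$, $L_\theta$ is the line in $\mathbb{R}^2$ through the origin containing $v_\theta$, and $\mathrm{proj}_\theta:\mathbb{R}^2\to L_\theta$ is the orthogonal projection. Regular Cantor sets: $K\subset\mathbb{R}$ is a regular Cantor set of class $C^{1+\alpha}$, $\alpha>0$, if: (i) there are disjoint compact (nondegenerate) intervals $I_1,\dots,I_r\subseteq[0,1]$ such that $K\subset I_1\cup\cdots\cup I_r$ and the boundary of each $I_i$ is contained in $K$; (ii) there is a $C^{1+\alpha}$ expanding map $\psi$ ($|\psi'|>1$) defined in a neighbourhood of $I_1\cup\cdots\cup I_r$ such that each $\psi(I_i)$ is the convex hull of a finite union of some of the intervals $I_j$, and such that (ii.1) for each $i\in\{1,\dots,r\}$ and all $n$ sufficiently big, $\psi^n(K\cap I_i)=K$; (ii.2) $K=\bigcap_{n\in\mathbb{N}}\psi^{-n}(I_1\cup\cdots\cup I_r)$, that is, $K$ is the set of points all of whose iterates under $\psi$ remain in $I_1\cup\cdots\cup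 I_r$. *)

theory Defs
  imports "HOL-Analysis.Analysis"
begin

section \<open>Hausdorff dimension\<close>

text \<open>
  The number \<open>|U|^s\<close>, with the usual conventions \<open>|{}|^s = 0\<close> and \<open>|U|^0 = 1\<close> for \<open>U\<close> nonempty.
  They have to be spelt out, since \<open>0 powr 0 = 0\<close> in HOL.
\<close>

definition diam_pow :: "real \<Rightarrow> 'a::metric_space set \<Rightarrow> ennreal" where
  "diam_pow s U =
     (if U = {} then 0 else if s = 0 then 1 else ennreal (diameter U powr s))"

text \<open>
  Boundedness of the covering sets is required explicitly, since \<^const>\<open>diameter\<close> need not be
  meaningful on unbounded sets. Finite covers are included, by padding with empty sets.
\<close>

definition hausdorff_premeasure :: "real \<Rightarrow> real \<Rightarrow> 'a::metric_space set \<Rightarrow> ennreal" where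
  "hausdorff_premeasure \<delta> s A =
     (INF U \<in> {U :: nat \<Rightarrow> 'a set. A \<subseteq> (\<Union>i. U i) \<and> (\<forall>i. bounded (U i) \<and> diameter (U i) \<le> \<delta>)}.
        \<Sum>i. diam_pow s (U i))"

definition hausdorff_measure :: "real \<Rightarrow> 'a::metric_space set \<Rightarrow> ennreal" where
  "hausdorff_measure s A = (SUP \<delta>\<in>{0<..}. hausdorff_premeasure \<delta> s A)"

definition HD :: "'a::metric_space set \<Rightarrow> ennreal" where
  "HD A = Inf {ennreal s | s. 0 \<le> s \<and> hausdorff_measure s A = 0}"


section \<open>Regular Cantor sets\<close>

text \<open>
  \<open>f\<close> is of class \<open>C^{1+\<alpha>}\<close> on the open set \<open>U\<close>, for a real \<open>\<alpha> > 0\<close>. We write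
  \<open>1 + \<alpha> = k + \<beta>\<close> with \<open>k \<ge> 1\<close> an integer and \<open>0 < \<beta> \<le> 1\<close>; then \<open>f\<close> is \<open>k\<close> times differentiable
  and its \<open>k\<close>-th derivative is locally \<open>\<beta>\<close>-Hoelder. For \<open>0 < \<alpha> \<le> 1\<close> we have \<open>k = 1\<close> and
  \<open>\<beta> = \<alpha>\<close>. For integer \<open>\<alpha>\<close> this is the class \<open>C^{\<alpha>,1}\<close>, which contains the classical
  \<open>C^{\<alpha>+1}\<close>.
\<close>

definition class_C1plus :: "real \<Rightarrow> (real \<Rightarrow> real) \<Rightarrow> real set \<Rightarrow> bool" where
  "class_C1plus \<alpha> f U \<longleftrightarrow>
     (let k = nat \<lceil>\<alpha>\<rceil>; \<beta> = 1 + \<alpha> - real k in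
      \<exists>D :: nat \<Rightarrow> real \<Rightarrow> real.
        (\<forall>x\<in>U. D 0 x = f x) \<and>
        (\<forall>j<k. \<forall>x\<in>U. (D j has_real_derivative D (Suc j) x) (at x)) \<and>
        (\<forall>x\<in>U. \<exists>\<epsilon>>0. \<exists>C. \<forall>y\<in>U \<inter> ball x \<epsilon>. \<forall>z\<in>U \<inter> ball x \<epsilon>.
           \<bar>D k y - D k z\<bar> \<le> C * \<bar>y - z\<bar> powr \<beta>))"

text \<open>
  The interval \<open>I i\<close> is \<open>{a i..b i}\<close>. The map \<open>\<psi>\<close> is defined on the open neighbourhood \<open>U\<close> of
  \<open>I 1 \<union> \<dots> \<union> I r\<close>. As a HOL function it is total, but its values outside of \<open>U\<close> are irrelevant:
  in (ii.1) and (ii.2) it is only iterated along orbits that stay in the union of the intervals.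
\<close>

definition regular_Cantor_set :: "real \<Rightarrow> real set \<Rightarrow> bool" where
  "regular_Cantor_set \<alpha> K \<longleftrightarrow>
     (\<exists>(r::nat) (a::nat \<Rightarrow> real) (b::nat \<Rightarrow> real) (U::real set) (\<psi>::real \<Rightarrow> real).
        let I = (\<lambda>i. {a i..b i}) in
        1 \<le> r \<and>
        (\<forall>i\<in>{1..r}. a i < b i \<and> I i \<subseteq> {0..1}) \<and>
        disjoint_family_on I {1..r} \<and>
        K \<subseteq> (\<Union>i\<in>{1..r}. I i) \<and>
        (\<forall>i\<in>{1..r}. frontier (I i) \<subseteq> K) \<and>
        open U \<and> (\<Union>i\<in>{1..r}. I i) \<subseteq> U \<and>
        class_C1plus \<alpha> \<psi> U \<and>
        (\<forall>x\<in>U. \<bar>deriv \<psi> x\<bar> > 1) \<and>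
        (\<forall>i\<in>{1..r}. \<exists>J\<subseteq>{1..r}. \<psi> ` I i = convex hull (\<Union>j\<in>J. I j)) \<and>
        (\<forall>i\<in>{1..r}. \<forall>\<^sub>F n in sequentially. (\<psi> ^^ n) ` (K \<inter> I i) = K) \<and>
        K = {x. \<forall>n. (\<psi> ^^ n) x \<in> (\<Union>i\<in>{1..r}. I i)})"


section \<open>Projections to lines through the origin\<close>

definition dir_vec :: "real \<Rightarrow> real \<times> real" where
  "dir_vec \<theta> = (cos \<theta>, sin \<theta>)"

definition line_dir :: "real \<Rightarrow> (real \<times> real) set" where
  "line_dir \<theta> = span {dir_vec \<theta>}"

definition proj :: "real \<Rightarrow> real \<times> real \<Rightarrow> real \<times> real" where
  "proj \<theta> p = (p \<bullet> dir_vec \<theta>) *\<^sub>R dir_vec \<theta>"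

text \<open>
  Lebesgue measure on \<open>line_dir \<theta>\<close>, transported from the real line by the isometry \<open>t \<mapsto> t *\<^sub>R dir_vec \<theta>\<close>.
\<close>

definition line_measure :: "real \<Rightarrow> (real \<times> real) set \<Rightarrow> ennreal" where
  "line_measure \<theta> A = emeasure lebesgue {t::real. t *\<^sub>R dir_vec \<theta> \<in> A}"

lemma norm_dir_vec [simp]: "norm (dir_vec \<theta>) = 1"
  by (simp add: dir_vec_def norm_Pair)

text \<open>\<^const>\<open>proj\<close> is the orthogonal projection to \<^const>\<open>line_dir\<close>:\<close>

lemma proj_eq_iff: "proj \<theta> p = q \<longleftrightarrow> q \<in> line_dir \<theta> \<and> (\<forall>w\<in>line_dir \<theta>. (p - q) \<bullet> w = 0)"
proof -
  have "dir_vec \<theta> \<bullet> dir_vec \<theta> = 1"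
    using norm_dir_vec[of \<theta>] by (simp add: dot_square_norm)
  then show ?thesis
    by (auto simp: proj_def line_dir_def span_singleton inner_diff_left)
qed

text \<open>The parametrization used in \<^const>\<open>line_measure\<close> is an isometry onto \<^const>\<open>line_dir\<close>:\<close>

lemma dist_scale_dir_vec: "dist (s *\<^sub>R dir_vec \<theta>) (t *\<^sub>R dir_vec \<theta>) = dist s t"
  by (simp add: dist_norm flip: scaleR_left_diff_distrib)

lemma range_scale_dir_vec: "range (\<lambda>t. t *\<^sub>R dir_vec \<theta>) = line_dir \<theta>"
  by (simp add: line_dir_def span_singleton)

end

theory Submission
  imports Defs
begin

text \<open>
  The Cantor structure enters only through compactness; the argument is a discretised form of the potential
  theoretic proof of Marstrand's theorem. Choose \<open>s + t > 1\<close> such that \<open>K\<^sub>1\<close> and \<open>K\<^sub>2\<close> have positive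
  \<open>s\<close>- and \<open>t\<close>-dimensional measure. At every scale \<open>\<delta> = 2\<^bsup>-N\<^esup>\<close> there are weights on the dyadic intervals
  meeting \<open>K\<^sub>i\<close> that satisfy the Frostman condition at all larger scales and have total mass bounded
  below. The set of slopes \<open>x \<in> [-M, M]\<close> for which the projections \<open>a + x b\<close> of two squares at distance \<open>D\<close>
  overlap has measure \<open>O(\<delta> / D)\<close>, so since \<open>s + t > 1\<close> the squared L2 norm of the projected density, integrated
  over \<open>x\<close>, stays bounded as \<open>\<delta> \<rightarrow> 0\<close>. For almost every \<open>x\<close> this norm is thus bounded along a
  sequence of scales (Fatou), the support of the density has measure bounded below (Cauchy--Schwarz),
  and so has its limit, the compact projection of \<open>K\<^sub>1 \<times> K\<^sub>2\<close>.
\<close>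

section \<open>Hausdorff dimension and dyadic intervals\<close>

text \<open>Half-open, so that the intervals of one level partition the nonnegative
  half-line.\<close>

definition dyadic_interval :: "nat \<Rightarrow> nat \<Rightarrow> real set" where
  "dyadic_interval k i = {real i / 2 ^ k ..< (real i + 1) / 2 ^ k}"

text \<open>The indices, \<open>m\<close> levels further down, of the dyadic intervals that make up
  the \<open>l\<close>-th one; coarse intervals thus become sets of fine indices.\<close>

definition block :: "nat \<Rightarrow> nat \<Rightarrow> nat set" where
  "block m l = {l * 2 ^ m ..< Suc l * 2 ^ m}"

lemma finite_block [simp]: "finite (block m l)"
  by (simp add: block_def)

lemma mem_block_iff: "j \<in> block m l \<longleftrightarrow> j div 2 ^ m = l"
  unfolding block_def atLeastLessThan_iff
  by (metis div_less_iff_less_mult less_Suc_eq_le less_eq_div_iff_mult_less_eq order_antisym order_refl pos2 zero_less_power)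

lemma dyadic_interval_split:
  "dyadic_interval k i = dyadic_interval (Suc k) (2 * i) \<union> dyadic_interval (Suc k) (2 * i + 1)"
  by (auto simp: dyadic_interval_def field_simps)

lemma block_split: "block (Suc m) l = block m (2 * l) \<union> block m (2 * l + 1)"
  by (auto simp: block_def algebra_simps)

lemma bounded_dyadic_interval: "bounded (dyadic_interval k i)"
  unfolding dyadic_interval_def
  by (rule bounded_subset[OF bounded_closed_interval[of "real i / 2 ^ k" "(real i + 1) / 2 ^ k"]]) auto

lemma diameter_dyadic_interval: "diameter (dyadic_interval k i) \<le> 1 / 2 ^ k"
  by (rule diameter_le) (auto simp: dyadic_interval_def field_simps abs_le_iff)

lemma diam_pow_dyadic_interval:
  assumes "0 \<le> s"
  shows "diam_pow s (dyadic_interval k i) \<le> ennreal (2 powr (- s * real k))"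
proof -
  have "diameter (dyadic_interval k i) powr s \<le> (1 / 2 ^ k) powr s"
    using assms diameter_dyadic_interval[of k i]
    by (intro powr_mono2) (auto simp: diameter_ge_0 bounded_dyadic_interval)
  also have "\<dots> = 2 powr (- s * real k)"
    by (simp add: powr_divide powr_minus_divide powr_powr mult.commute flip: powr_realpow)
  finally show ?thesis
    by (simp add: diam_pow_def ennreal_leI)
qed

lemma hausdorff_premeasure_le:
  assumes "A \<subseteq> U" "bounded U" "diameter U \<le> \<delta>" "0 \<le> \<delta>"
  shows "hausdorff_premeasure \<delta> s A \<le> diam_pow s U"
proof -
  define V where "V = (\<lambda>i::nat. if i = 0 then U else {})"
  have "hausdorff_premeasure \<delta> s A \<le> (\<Sum>i. diam_pow s (V i))"
    unfolding hausdorff_premeasure_def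
    by (rule INF_lower) (use assms in \<open>auto simp: V_def\<close>)
  also have "\<dots> = (\<Sum>i\<in>{0}. diam_pow s (V i))"
    by (rule suminf_finite) (auto simp: V_def diam_pow_def)
  finally show ?thesis by (simp add: V_def)
qed

text \<open>Interleaving a cover of \<open>A\<close> with a cover of \<open>B\<close> covers the
  union at the sum of the two costs; apply this to nearly optimal covers.\<close>

lemma hausdorff_premeasure_Un:
  "hausdorff_premeasure \<delta> s (A \<union> B) \<le> hausdorff_premeasure \<delta> s A + hausdorff_premeasure \<delta> s B"
proof -
  define C where "C = (\<lambda>A::'a set. {U :: nat \<Rightarrow> 'a set. A \<subseteq> (\<Union>i. U i) \<and> (\<forall>i. bounded (U i) \<and> diameter (U i) \<le> \<delta>)})"
  have pm: "hausdorff_premeasure \<delta> s A = (INF U\<in>C A. \<Sum>i. diam_pow s (U i))" for A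
    by (simp add: hausdorff_premeasure_def C_def)
  have key: "hausdorff_premeasure \<delta> s (A \<union> B) \<le> (\<Sum>i. diam_pow s (U i)) + (\<Sum>i. diam_pow s (V i))"
    if U: "U \<in> C A" and V: "V \<in> C B" for U V
  proof -
    define W where "W = (\<lambda>i. if even i then U (i div 2) else V (i div 2))"
    have WU: "W (2 * i) = U i" and WV: "W (2 * i + 1) = V i" for i
      by (auto simp: W_def)
    have "(\<Union>i. U i) \<subseteq> (\<Union>i. W i)" "(\<Union>i. V i) \<subseteq> (\<Union>i. W i)"
      using WU WV by (auto; metis)+
    then have "W \<in> C (A \<union> B)"
      using U V unfolding C_def W_def mem_Collect_eq by (intro conjI Un_least) (blast, blast, simp)
    then have "hausdorff_premeasure \<delta> s (A \<union> B) \<le> (\<Sum>i. diam_pow s (W i))"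
      unfolding pm by (rule INF_lower)
    also have "\<dots> = (\<Sum>i. (if even i then diam_pow s (W i) else 0) + (if odd i then diam_pow s (W i) else 0))"
      by (intro suminf_cong) auto
    also have "\<dots> = (\<Sum>i. if even i then diam_pow s (W i) else 0) + (\<Sum>i. if odd i then diam_pow s (W i) else 0)"
      by (rule suminf_add[symmetric]) auto
    also have "(\<Sum>i. if even i then diam_pow s (W i) else 0) = (\<Sum>i. diam_pow s (U i))"
    proof -
      have "(\<Sum>i. if even (2 * i) then diam_pow s (W (2 * i)) else 0) = (\<Sum>i. if even i then diam_pow s (W i) else 0)"
        by (rule suminf_mono_reindex) (auto simp: strict_mono_def elim!: evenE)
      then show ?thesis by (simp add: WU)
    qed
    also have "(\<Sum>i. if odd i then diam_pow s (W i) else 0) = (\<Sum>i. diam_pow s (V i))"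
    proof -
      have "(\<Sum>i. if odd (2 * i + 1) then diam_pow s (W (2 * i + 1)) else 0) = (\<Sum>i. if odd i then diam_pow s (W i) else 0)"
        by (rule suminf_mono_reindex) (auto simp: strict_mono_def elim!: oddE)
      then show ?thesis using WV by simp
    qed
    finally show ?thesis .
  qed
  show ?thesis
  proof (rule ennreal_le_epsilon)
    fix e :: real
    assume fin: "hausdorff_premeasure \<delta> s A + hausdorff_premeasure \<delta> s B < top" and "0 < e"
    then have e: "e / 2 > 0" by simp
    obtain U where U: "U \<in> C A" "(\<Sum>i. diam_pow s (U i)) < hausdorff_premeasure \<delta> s A + ennreal (e / 2)"
      using INF_approx_ennreal[OF e pm[of A]] fin by (auto simp: less_top)
    obtain V where V: "V \<in> C B" "(\<Sum>i. diam_pow s (V i)) < hausdorff_premeasure \<delta> s B + ennreal (e / 2)"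
      using INF_approx_ennreal[OF e pm[of B]] fin by (auto simp: less_top)
    have "hausdorff_premeasure \<delta> s (A \<union> B) \<le>
      (hausdorff_premeasure \<delta> s A + ennreal (e / 2)) + (hausdorff_premeasure \<delta> s B + ennreal (e / 2))"
      using key[OF U(1) V(1)] U(2) V(2) by (meson add_mono less_imp_le order_trans)
    also have "\<dots> = hausdorff_premeasure \<delta> s A + hausdorff_premeasure \<delta> s B + (ennreal (e / 2) + ennreal (e / 2))"
      by (simp add: ac_simps)
    also have "ennreal (e / 2) + ennreal (e / 2) = ennreal e"
      using \<open>0 < e\<close> by (simp flip: ennreal_plus)
    finally show "hausdorff_premeasure \<delta> s (A \<union> B) \<le> hausdorff_premeasure \<delta> s A + hausdorff_premeasure \<delta> s B + ennreal e" .
  qed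
qed

section \<open>Exponents below the Hausdorff dimension\<close>

lemma hausdorff_measure_zero_dim:
  assumes "A \<noteq> {}"
  shows "hausdorff_measure 0 A \<noteq> 0"
proof -
  obtain x where x: "x \<in> A" using assms by auto
  have "1 \<le> hausdorff_premeasure 1 0 A"
    unfolding hausdorff_premeasure_def
  proof (rule INF_greatest)
    fix U :: "nat \<Rightarrow> 'a set"
    assume "U \<in> {U. A \<subseteq> (\<Union>i. U i) \<and> (\<forall>i. bounded (U i) \<and> diameter (U i) \<le> 1)}"
    then obtain i where "x \<in> U i" using x by auto
    then have "1 = diam_pow 0 (U i)" by (auto simp: diam_pow_def)
    also have "\<dots> = (\<Sum>j\<in>{i}. diam_pow 0 (U j))" by simp
    also have "\<dots> \<le> (\<Sum>j. diam_pow 0 (U j))" by (rule sum_le_suminf) auto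
    finally show "1 \<le> (\<Sum>j. diam_pow 0 (U j))" .
  qed
  also have "\<dots> \<le> hausdorff_measure 0 A"
    unfolding hausdorff_measure_def by (rule SUP_upper) simp
  finally show ?thesis by auto
qed

text \<open>The exponent 0 is treated separately, as no exponent lies strictly below a dimension
  equal to 0; at exponent 0 every covering set that contains a given point already costs 1.\<close>

lemma hausdorff_measure_nonzero_below_HD:
  assumes "A \<noteq> {}" "0 \<le> s" "s = 0 \<or> ennreal s < HD A"
  shows "hausdorff_measure s A \<noteq> 0"
proof
  assume *: "hausdorff_measure s A = 0"
  then have "HD A \<le> ennreal s"
    unfolding HD_def using assms by (intro Inf_lower) auto
  then show False
    using * assms hausdorff_measure_zero_dim[of A] by auto
qed

text \<open>If one dimension exceeds 1, an exponent above 1 there pairs with the exponent 0 for the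
  other set. If both are at most 1 they are finite, and each can be lowered by a third of the excess
  over 1.\<close>

lemma exponents_below_HD:
  assumes "A \<noteq> {}" "B \<noteq> {}" "HD A + HD B > 1"
  obtains s t where "0 \<le> s" "0 \<le> t" "s + t > 1" "hausdorff_measure s A \<noteq> 0" "hausdorff_measure t B \<noteq> 0"
proof -
  have big: "\<exists>s>1. hausdorff_measure s C \<noteq> 0" if h: "HD C > 1" "C \<noteq> {}" for C :: "'c::metric_space set"
  proof -
    obtain q where q: "1 < q" "q < HD C" using dense[OF h(1)] by auto
    then obtain s where s: "q = ennreal s" "0 \<le> s"
      by (metis ennreal_cases not_top_less)
    then have "s > 1" using q(1) by (simp add: ennreal_less_iff flip: ennreal_1)
    then show ?thesis
      using hausdorff_measure_nonzero_below_HD[of C s] h q s by auto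
  qed
  consider "HD A > 1" | "HD B > 1" | "HD A \<le> 1" "HD B \<le> 1" by force
  then show ?thesis
  proof cases
    case 1
    then obtain s where "s > 1" "hausdorff_measure s A \<noteq> 0" using big assms by blast
    then show ?thesis using that[of s 0] hausdorff_measure_zero_dim[of B] assms by auto
  next
    case 2
    then obtain s where "s > 1" "hausdorff_measure s B \<noteq> 0" using big assms by blast
    then show ?thesis using that[of 0 s] hausdorff_measure_zero_dim[of A] assms by auto
  next
    case 3
    define a b where "a = enn2real (HD A)" and "b = enn2real (HD B)"
    have ab: "HD A = ennreal a" "HD B = ennreal b" "a \<ge> 0" "b \<ge> 0"
      using 3 by (auto simp: a_def b_def ennreal_enn2real_if top_unique)
    have "a + b > 1"
      using assms(3) ab by (simp add: ennreal_less_iff flip: ennreal_plus ennreal_1)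
    define e where "e = (a + b - 1) / 3"
    have e: "e > 0" "a - e + (b - e) > 1" using \<open>a + b > 1\<close> by (auto simp: e_def field_simps)
    show ?thesis
    \<comment> \<open>Truncation at 0 keeps the exponents admissible and can only raise their
      sum.\<close>
    proof (rule that[of "max 0 (a - e)" "max 0 (b - e)"])
      show "hausdorff_measure (max 0 (a - e)) A \<noteq> 0"
        using e ab assms by (intro hausdorff_measure_nonzero_below_HD) (auto simp: max_def ennreal_less_iff)
      show "hausdorff_measure (max 0 (b - e)) B \<noteq> 0"
        using e ab assms by (intro hausdorff_measure_nonzero_below_HD) (auto simp: max_def ennreal_less_iff)
    qed (use e in auto)
  qed
qed

section \<open>Frostman weights on dyadic intervals\<close>

text \<open>
  Weights built from the bottom up: join the weights of the two halves, and scale them down whenever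
  their total exceeds \<open>2\<^bsup>-sk\<^esup>\<close>, which dominates the premeasure of the piece at hand.
\<close>

lemma discrete_frostman:
  assumes s: "0 \<le> s" and k: "1 / 2 ^ k \<le> \<delta>"
  shows "\<exists>w :: nat \<Rightarrow> real. (\<forall>j. 0 \<le> w j) \<and>
    (\<forall>j. w j \<noteq> 0 \<longrightarrow> j \<in> block n i \<and> dyadic_interval (k + n) j \<inter> K \<noteq> {}) \<and>
    (\<forall>m\<le>n. \<forall>l. sum w (block m l) \<le> 2 powr (- s * real (k + n - m))) \<and>
    hausdorff_premeasure \<delta> s (K \<inter> dyadic_interval k i) \<le> ennreal (sum w (block n i))"
  using k
proof (induction n arbitrary: k i)
  case 0
  \<comment> \<open>A single interval carries the largest admissible weight if it meets
    \<open>K\<close>, and none otherwise.\<close>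
  define w where "w = (\<lambda>j. if j = i \<and> dyadic_interval k i \<inter> K \<noteq> {} then 2 powr (- s * real k) else 0)"
  have "0 < 1 / (2::real) ^ k" by simp
  then have "0 \<le> \<delta>" using 0 by linarith
  have "hausdorff_premeasure \<delta> s (K \<inter> dyadic_interval k i) \<le> ennreal (w i)"
  proof (cases "dyadic_interval k i \<inter> K = {}")
    case True
    then have "hausdorff_premeasure \<delta> s (K \<inter> dyadic_interval k i) \<le> diam_pow s ({} :: real set)"
      using \<open>0 \<le> \<delta>\<close> by (intro hausdorff_premeasure_le) auto
    then show ?thesis by (simp add: diam_pow_def)
  next
    case False
    have "hausdorff_premeasure \<delta> s (K \<inter> dyadic_interval k i) \<le> diam_pow s (dyadic_interval k i)"
      using \<open>0 \<le> \<delta>\<close> 0 diameter_dyadic_interval[of k i]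
      by (intro hausdorff_premeasure_le) (auto simp: bounded_dyadic_interval)
    with diam_pow_dyadic_interval[OF s, of k i] False show ?thesis by (simp add: w_def)
  qed
  then show ?case
    by (intro exI[of _ w]) (auto simp: w_def block_def)
next
  case (Suc n)
  have "1 / 2 ^ Suc k \<le> 1 / (2::real) ^ k" by (simp add: field_simps)
  then have k: "1 / 2 ^ Suc k \<le> \<delta>" using Suc.prems by linarith
  obtain u where u: "\<And>j. 0 \<le> u j"
      "\<And>j. u j \<noteq> 0 \<Longrightarrow> j \<in> block n (2 * i) \<and> dyadic_interval (Suc k + n) j \<inter> K \<noteq> {}"
      "\<And>m l. m \<le> n \<Longrightarrow> sum u (block m l) \<le> 2 powr (- s * real (Suc k + n - m))"
      "hausdorff_premeasure \<delta> s (K \<inter> dyadic_interval (Suc k) (2 * i)) \<le> ennreal (sum u (block n (2 * i)))"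
    using Suc.IH[OF k, of "2 * i"] by blast
  obtain v where v: "\<And>j. 0 \<le> v j"
      "\<And>j. v j \<noteq> 0 \<Longrightarrow> j \<in> block n (2 * i + 1) \<and> dyadic_interval (Suc k + n) j \<inter> K \<noteq> {}"
      "\<And>m l. m \<le> n \<Longrightarrow> sum v (block m l) \<le> 2 powr (- s * real (Suc k + n - m))"
      "hausdorff_premeasure \<delta> s (K \<inter> dyadic_interval (Suc k) (2 * i + 1)) \<le> ennreal (sum v (block n (2 * i + 1)))"
    using Suc.IH[OF k, of "2 * i + 1"] by blast
  define T where "T = sum u (block n (2 * i)) + sum v (block n (2 * i + 1))"
  \<comment> \<open>Scaling by \<open>c \<le> 1\<close> caps the total at
    \<open>2 powr (- s * real k)\<close> and preserves the bounds already known on smaller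
    blocks.\<close>
  define c where "c = (if T \<le> 2 powr (- s * real k) then 1 else 2 powr (- s * real k) / T)"
  define w where "w = (\<lambda>j. c * (u j + v j))"
  have T: "T \<ge> 0" unfolding T_def using u(1) v(1) by (intro add_nonneg_nonneg sum_nonneg) auto
  have c: "0 \<le> c" "c \<le> 1" "c * T \<le> 2 powr (- s * real k)" 
    using T powr_gt_zero[of 2 "- s * real k"] by (auto simp: c_def divide_le_eq)
  have wsupp: "j \<in> block (Suc n) i \<and> dyadic_interval (k + Suc n) j \<inter> K \<noteq> {}" if "w j \<noteq> 0" for j
  proof -
    have "u j \<noteq> 0 \<or> v j \<noteq> 0" using that by (auto simp: w_def)
    then show ?thesis using u(2)[of j] v(2)[of j] unfolding block_split by auto
  qed
  have Suc_block: "sum w (block (Suc n) i) = c * T"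
  proof -
    have "sum u (block (Suc n) i) = sum u (block n (2 * i))"
    proof (rule sum.mono_neutral_right)
      show "\<forall>j\<in>block (Suc n) i - block n (2 * i). u j = 0" using u(2) by blast
    qed (auto simp: block_split)
    moreover have "sum v (block (Suc n) i) = sum v (block n (2 * i + 1))"
    proof (rule sum.mono_neutral_right)
      show "\<forall>j\<in>block (Suc n) i - block n (2 * i + 1). v j = 0" using v(2) by blast
    qed (auto simp: block_split)
    ultimately show ?thesis
      by (simp add: w_def T_def sum.distrib flip: sum_distrib_left)
  qed
  have small: "sum w (block m l) \<le> 2 powr (- s * real (k + Suc n - m))" if m: "m \<le> n" for m l
  proof -
    \<comment> \<open>A block with \<open>m \<le> n\<close> lies inside one block of size
      \<open>2 ^ n\<close>, where at most one of \<open>u\<close> and \<open>v\<close> is nonzero,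
      so joining the weights creates no excess.\<close>
    have "j div 2 ^ n = l div 2 ^ (n - m)" if "j \<in> block m l" for j
    proof -
      have "j div 2 ^ n = j div 2 ^ m div 2 ^ (n - m)"
        using m by (simp flip: div_mult2_eq power_add)
      then show ?thesis using that by (simp add: mem_block_iff)
    qed
    then have "(\<forall>j\<in>block m l. u j = 0) \<or> (\<forall>j\<in>block m l. v j = 0)"
      using u(2) v(2) unfolding mem_block_iff[of _ n] by (metis Suc_eq_plus1 double_not_eq_Suc_double)
    then have "sum u (block m l) = 0 \<or> sum v (block m l) = 0" by (metis sum.neutral)
    then have "sum u (block m l) + sum v (block m l) \<le> 2 powr (- s * real (k + Suc n - m))"
      using u(3)[OF m, of l] v(3)[OF m, of l] by auto
    moreover have "0 \<le> sum u (block m l) + sum v (block m l)"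
      using u(1) v(1) by (intro add_nonneg_nonneg sum_nonneg) auto
    ultimately have "c * (sum u (block m l) + sum v (block m l)) \<le> 2 powr (- s * real (k + Suc n - m))"
      using c by (meson mult_left_le_one_le order_trans)
    then show ?thesis by (simp add: w_def sum.distrib flip: sum_distrib_left)
  qed
  have large: "sum w (block (Suc n) l) \<le> 2 powr (- s * real k)" for l
  proof (cases "l = i")
    case True
    then show ?thesis using c Suc_block by simp
  next
    case False
    then have "sum w (block (Suc n) l) = 0"
      using wsupp by (intro sum.neutral) (metis mem_block_iff)
    then show ?thesis by simp
  qed
  \<comment> \<open>Without capping this is subadditivity over the two halves. With capping the
    total equals \<open>2 powr (- s * real k)\<close>, and the interval itself is a cover of at most
    that cost.\<close>
  have "hausdorff_premeasure \<delta> s (K \<inter> dyadic_interval k i) \<le> ennreal (c * T)"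
  proof (cases "T \<le> 2 powr (- s * real k)")
    case True
    have split: "K \<inter> dyadic_interval k i = K \<inter> dyadic_interval (Suc k) (2 * i) \<union> K \<inter> dyadic_interval (Suc k) (2 * i + 1)"
      by (subst dyadic_interval_split) blast
    have "hausdorff_premeasure \<delta> s (K \<inter> dyadic_interval k i)
        \<le> ennreal (sum u (block n (2 * i))) + ennreal (sum v (block n (2 * i + 1)))"
      unfolding split by (rule order_trans[OF hausdorff_premeasure_Un add_mono[OF u(4) v(4)]])
    also have "\<dots> = ennreal T"
      unfolding T_def using u(1) v(1) by (intro ennreal_plus[symmetric] sum_nonneg) auto
    finally show ?thesis using True by (simp add: c_def)
  next
    case False
    have "0 < 1 / (2::real) ^ k" by simp
    then have "0 \<le> \<delta>" using Suc.prems by linarith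
    then have "hausdorff_premeasure \<delta> s (K \<inter> dyadic_interval k i) \<le> diam_pow s (dyadic_interval k i)"
      using Suc.prems diameter_dyadic_interval[of k i]
      by (intro hausdorff_premeasure_le) (auto simp: bounded_dyadic_interval)
    also have "\<dots> \<le> ennreal (2 powr (- s * real k))"
      by (rule diam_pow_dyadic_interval[OF s])
    also have "2 powr (- s * real k) = c * T"
      using False T powr_gt_zero[of 2 "- s * real k"] by (auto simp: c_def)
    finally show ?thesis .
  qed
  moreover have "0 \<le> w j" for j using u(1)[of j] v(1)[of j] c by (simp add: w_def)
  moreover have "sum w (block m l) \<le> 2 powr (- s * real (k + Suc n - m))" if "m \<le> Suc n" for m l
    using that small large[of l] by (cases "m = Suc n") auto
  ultimately show ?case
    using wsupp Suc_block by (intro exI[of _ w]) auto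
qed

text \<open>Finite subadditivity is enough, since finitely many intervals of level \<open>k\<close>
  cover \<open>K\<close>.\<close>

lemma dyadic_interval_positive_premeasure:
  assumes K: "K \<subseteq> {0..1}" and pos: "hausdorff_premeasure \<delta> s K \<noteq> 0" and "0 \<le> \<delta>"
  obtains i where "hausdorff_premeasure \<delta> s (K \<inter> dyadic_interval k i) \<noteq> 0"
proof (rule ccontr)
  assume "\<not> thesis"
  then have null: "hausdorff_premeasure \<delta> s (K \<inter> dyadic_interval k i) = 0" for i
    using that by auto
  have "hausdorff_premeasure \<delta> s (K \<inter> {0..<real N / 2 ^ k}) = 0" for N
  proof (induction N)
    case 0
    have "hausdorff_premeasure \<delta> s (K \<inter> {0..<real 0 / 2 ^ k}) \<le> diam_pow s ({} :: real set)"
      using assms(3) by (intro hausdorff_premeasure_le) auto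
    then show ?case by (simp add: diam_pow_def)
  next
    case (Suc N)
    have "0 \<le> real N / 2 ^ k" "real N / 2 ^ k \<le> real (Suc N) / 2 ^ k"
      by (auto simp: field_simps)
    then have "K \<inter> {0..<real (Suc N) / 2 ^ k} = (K \<inter> {0..<real N / 2 ^ k}) \<union> (K \<inter> dyadic_interval k N)"
      using K unfolding dyadic_interval_def by (auto simp: add.commute subset_iff intro: less_le_trans)
    then show ?case
      using hausdorff_premeasure_Un[of \<delta> s "K \<inter> {0..<real N / 2 ^ k}" "K \<inter> dyadic_interval k N"] Suc null
      by simp
  qed
  \<comment> \<open>One interval beyond the first \<open>2 ^ k\<close>, in order to include the
    point 1.\<close>
  from this[of "2 ^ k + 1"] have "hausdorff_premeasure \<delta> s (K \<inter> {0..<1 + 1 / 2 ^ k}) = 0"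
    by (simp add: field_simps)
  moreover have "K \<inter> {0..<1 + 1 / 2 ^ k} = K"
  proof -
    have "0 < 1 / (2::real) ^ k" by simp
    then have "x < 1 + 1 / 2 ^ k" if "x \<in> K" for x
      using K that by (intro le_less_trans[of x 1]) auto
    then show ?thesis using K by (auto simp: subset_iff)
  qed
  ultimately show False using pos by simp
qed

section \<open>The discrete energy\<close>

text \<open>Indices closer than \<open>2 ^ m\<close> to \<open>i\<close> lie in the block of
  \<open>i\<close> or in one of its two neighbours.\<close>

lemma sum_near_le:
  fixes w :: "nat \<Rightarrow> real"
  assumes "finite B" and w: "\<And>j. 0 \<le> w j" and c: "\<And>l. sum w (block m l) \<le> c"
  shows "(\<Sum>j\<in>B. w j * of_bool (\<bar>real i - real j\<bar> < 2 ^ m)) \<le> 3 * c"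
proof -
  define l where "l = i div 2 ^ m"
  have le_c: "(\<Sum>j\<in>B. w j * of_bool (j \<in> block m l')) \<le> c" for l'
  proof -
    have "(\<Sum>j\<in>B. w j * of_bool (j \<in> block m l')) = sum w (B \<inter> block m l')"
      using \<open>finite B\<close> by (simp add: of_bool_def if_distrib sum.inter_restrict cong: if_cong)
    also have "\<dots> \<le> sum w (block m l')"
      using w by (intro sum_mono2) auto
    finally show ?thesis using c[of l'] by linarith
  qed
  \<comment> \<open>For \<open>l = 0\<close> the truncated \<open>l - 1\<close> repeats the block
    \<open>l\<close>, which is harmless in an upper bound.\<close>
  have near: "j \<in> block m (l - 1) \<or> j \<in> block m l \<or> j \<in> block m (l + 1)"
    if "\<bar>real i - real j\<bar> < 2 ^ m" for j
  proof -
    have "real i < real (j + 2 ^ m)" "real j < real (i + 2 ^ m)" using that by auto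
    then have "i \<le> j + 2 ^ m" "j \<le> i + 2 ^ m" by linarith+
    from this[THEN div_le_mono, of "2 ^ m"] have "l \<le> j div 2 ^ m + 1" "j div 2 ^ m \<le> l + 1"
      by (simp_all add: l_def)
    then show ?thesis unfolding mem_block_iff by linarith
  qed
  have "(\<Sum>j\<in>B. w j * of_bool (\<bar>real i - real j\<bar> < 2 ^ m)) \<le>
    (\<Sum>j\<in>B. w j * of_bool (j \<in> block m (l - 1)) + w j * of_bool (j \<in> block m l) + w j * of_bool (j \<in> block m (l + 1)))"
    using near w by (intro sum_mono) (fastforce simp: of_bool_def)
  also have "\<dots> \<le> 3 * c"
    using le_c[of "l - 1"] le_c[of l] le_c[of "l + 1"] by (simp add: sum.distrib)
  finally show ?thesis .
qed

text \<open>The term of the least \<open>m\<close> with both numbers below \<open>2 ^ m\<close>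
  suffices: by minimality the left denominator is at least half of \<open>2 ^ m\<close>. The product
  of two indicators lets the energy factor over the coordinates.\<close>

lemma inverse_max_le_dyadic_sum:
  fixes x y :: real
  assumes "x < 2 ^ n" "y < 2 ^ n"
  shows "1 / max 1 (max x y) \<le> (\<Sum>m\<le>n. 2 / 2 ^ m * (of_bool (x < 2 ^ m) * of_bool (y < 2 ^ m)))"
proof -
  define m where "m = (LEAST m. x < 2 ^ m \<and> y < 2 ^ m)"
  have m: "x < 2 ^ m \<and> y < 2 ^ m" and "m \<le> n"
    unfolding m_def using assms by (auto intro: LeastI2 Least_le)
  have "1 / max 1 (max x y) \<le> 2 / 2 ^ m"
  proof (cases m)
    case 0
    then show ?thesis by (simp add: field_simps)
  next
    case (Suc m')
    then have "\<not> (x < 2 ^ m' \<and> y < 2 ^ m')"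
      using not_less_Least[of m' "\<lambda>m. x < 2 ^ m \<and> y < 2 ^ m"] by (simp add: m_def)
    then have "2 ^ m' \<le> max 1 (max x y)" by auto
    then have "1 / max 1 (max x y) \<le> 1 / 2 ^ m'" by (intro divide_left_mono) auto
    then show ?thesis using Suc by simp
  qed
  also have "\<dots> = (\<Sum>m\<in>{m}. 2 / 2 ^ m * (of_bool (x < 2 ^ m) * of_bool (y < 2 ^ m)))"
    using m by simp
  also have "\<dots> \<le> (\<Sum>m\<le>n. 2 / 2 ^ m * (of_bool (x < 2 ^ m) * of_bool (y < 2 ^ m)))"
    using \<open>m \<le> n\<close> by (intro sum_mono2) auto
  finally show ?thesis .
qed

lemma sum_fst_times_snd:
  fixes f :: "'a \<Rightarrow> 'c::semiring_0" and g :: "'b \<Rightarrow> 'c"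
  shows "(\<Sum>q\<in>A \<times> B. f (fst q) * g (snd q)) = sum f A * sum g B"
  by (simp add: sum_product sum.cartesian_product case_prod_beta)

text \<open>Sup-norm distance between the corners of two squares in units of their side, cut off at
  1 so that the reciprocal stays bounded near the diagonal.\<close>

definition block_dist :: "nat \<times> nat \<Rightarrow> nat \<times> nat \<Rightarrow> real" where
  "block_dist p q = max 1 (max \<bar>real (fst p) - real (fst q)\<bar> \<bar>real (snd p) - real (snd q)\<bar>)"

text \<open>Decompose the kernel dyadically. Within \<open>2 ^ m\<close> of \<open>p\<close> each
  factor has mass at most 3 times its Frostman bound, so the scales add up to a geometric series of
  ratio \<open>2 powr (1 - s - t)\<close>, which is below 1 since \<open>s + t > 1\<close>.\<close>

lemma discrete_energy_le:
  fixes u v :: "nat \<Rightarrow> real"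
  assumes u: "\<And>j. 0 \<le> u j" "\<And>m l. m \<le> n \<Longrightarrow> sum u (block m l) \<le> 2 powr (- s * real (k + n - m))"
    and v: "\<And>j. 0 \<le> v j" "\<And>m l. m \<le> n \<Longrightarrow> sum v (block m l) \<le> 2 powr (- t * real (k + n - m))"
    and st: "s + t > 1"
    and p: "p \<in> block n a \<times> block n b"
  shows "(\<Sum>q\<in>block n a \<times> block n b. u (fst q) * v (snd q) / block_dist p q)
    \<le> 18 / (1 - 2 powr (1 - s - t)) / 2 ^ (k + n)"
proof -
  define r where "r = (2::real) powr (1 - s - t)"
  have r: "0 < r" "r < 1" using st by (auto simp: r_def powr_less_one)
  define U where "U = (\<lambda>m. \<Sum>j\<in>block n a. u j * of_bool (\<bar>real (fst p) - real j\<bar> < 2 ^ m))"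
  define V where "V = (\<lambda>m. \<Sum>j\<in>block n b. v j * of_bool (\<bar>real (snd p) - real j\<bar> < 2 ^ m))"
  have block_diff: "\<bar>real i - real j\<bar> < 2 ^ n" if "i \<in> block n l" "j \<in> block n l" for i j l
  proof -
    have "i < j + 2 ^ n" "j < i + 2 ^ n" using that by (auto simp: block_def)
    then have "real i < real (j + 2 ^ n)" "real j < real (i + 2 ^ n)" by (auto simp only: of_nat_less_iff)
    then show ?thesis by auto
  qed
  have "(\<Sum>q\<in>block n a \<times> block n b. u (fst q) * v (snd q) / block_dist p q)
    \<le> (\<Sum>q\<in>block n a \<times> block n b. u (fst q) * v (snd q) * (\<Sum>m\<le>n. 2 / 2 ^ m *
        (of_bool (\<bar>real (fst p) - real (fst q)\<bar> < 2 ^ m) * of_bool (\<bar>real (snd p) - real (snd q)\<bar> < 2 ^ m))))"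
  proof (rule sum_mono)
    fix q assume q: "q \<in> block n a \<times> block n b"
    have "1 / block_dist p q \<le> (\<Sum>m\<le>n. 2 / 2 ^ m *
        (of_bool (\<bar>real (fst p) - real (fst q)\<bar> < 2 ^ m) * of_bool (\<bar>real (snd p) - real (snd q)\<bar> < 2 ^ m)))"
      unfolding block_dist_def using p q by (intro inverse_max_le_dyadic_sum block_diff) auto
    then have "u (fst q) * v (snd q) * (1 / block_dist p q) \<le> u (fst q) * v (snd q) * (\<Sum>m\<le>n. 2 / 2 ^ m *
        (of_bool (\<bar>real (fst p) - real (fst q)\<bar> < 2 ^ m) * of_bool (\<bar>real (snd p) - real (snd q)\<bar> < 2 ^ m)))"
      using u(1) v(1) by (intro mult_left_mono) auto
    then show "u (fst q) * v (snd q) / block_dist p q \<le> u (fst q) * v (snd q) * (\<Sum>m\<le>n. 2 / 2 ^ m *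
        (of_bool (\<bar>real (fst p) - real (fst q)\<bar> < 2 ^ m) * of_bool (\<bar>real (snd p) - real (snd q)\<bar> < 2 ^ m)))"
      by simp
  qed
  also have "\<dots> = (\<Sum>m\<le>n. \<Sum>q\<in>block n a \<times> block n b. 2 / 2 ^ m * 
      ((u (fst q) * of_bool (\<bar>real (fst p) - real (fst q)\<bar> < 2 ^ m)) * (v (snd q) * of_bool (\<bar>real (snd p) - real (snd q)\<bar> < 2 ^ m))))"
    unfolding sum_distrib_left by (subst sum.swap) (simp add: mult_ac)
  also have "\<dots> = (\<Sum>m\<le>n. 2 / 2 ^ m * (U m * V m))"
    unfolding U_def V_def sum_distrib_left[symmetric]
    using sum_fst_times_snd[of "\<lambda>j. u j * of_bool (\<bar>real (fst p) - real j\<bar> < 2 ^ _)"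
      "\<lambda>j. v j * of_bool (\<bar>real (snd p) - real j\<bar> < 2 ^ _)"]
    by (intro sum.cong refl arg_cong[where f = "(*) _"]) simp
  \<comment> \<open>18 is \<open>2 * 3 * 3\<close>: the kernel bound times three blocks in each
    coordinate. A factor \<open>r ^ k\<close>, at most 1, is dropped.\<close>
  also have "\<dots> \<le> (\<Sum>m\<le>n. 18 / 2 ^ (k + n) * r ^ (n - m))"
  proof (rule sum_mono)
    fix m assume "m \<in> {..n}"
    then have m: "m \<le> n" by simp
    have "U m \<le> 3 * 2 powr (- s * real (k + n - m))"
      unfolding U_def using u m by (intro sum_near_le) auto
    moreover have "V m \<le> 3 * 2 powr (- t * real (k + n - m))"
      unfolding V_def using v m by (intro sum_near_le) auto
    moreover have "0 \<le> V m"
      unfolding V_def using v by (intro sum_nonneg) auto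
    ultimately have "U m * V m \<le> (3 * 2 powr (- s * real (k + n - m))) * (3 * 2 powr (- t * real (k + n - m)))"
      by (intro mult_mono) auto
    then have "2 / 2 ^ m * (U m * V m) \<le> 2 / 2 ^ m * (9 * (2 powr (- s * real (k + n - m)) * 2 powr (- t * real (k + n - m))))"
      by (intro mult_left_mono) auto
    also have "\<dots> = 18 / 2 ^ (k + n) * (2 ^ (k + n - m) * (2 powr (- s * real (k + n - m)) * 2 powr (- t * real (k + n - m))))"
      using m by (simp add: power_diff field_simps)
    also have "2 ^ (k + n - m) * (2 powr (- s * real (k + n - m)) * 2 powr (- t * real (k + n - m))) = r ^ (k + n - m)"
    proof -
      have "2 ^ N * (2 powr (- s * real N) * 2 powr (- t * real N)) = r ^ N" for N
      proof -
        have "2 ^ N * (2 powr (- s * real N) * 2 powr (- t * real N))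
            = 2 powr (real N + (- s * real N + - t * real N))"
          unfolding powr_add by (simp add: powr_realpow)
        also have "\<dots> = 2 powr ((1 - s - t) * real N)"
          by (simp add: algebra_simps)
        also have "\<dots> = r ^ N"
          by (simp add: r_def powr_powr flip: powr_realpow)
        finally show ?thesis .
      qed
      then show ?thesis .
    qed
    also have "18 / 2 ^ (k + n) * r ^ (k + n - m) \<le> 18 / 2 ^ (k + n) * r ^ (n - m)"
      using r by (intro mult_left_mono power_decreasing) auto
    finally show "2 / 2 ^ m * (U m * V m) \<le> 18 / 2 ^ (k + n) * r ^ (n - m)" .
  qed
  also have "\<dots> = 18 / 2 ^ (k + n) * (\<Sum>m\<le>n. r ^ m)"
    unfolding sum_distrib_left[symmetric] atMost_atLeast0 by (subst sum.atLeastAtMost_rev) simp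
  also have "\<dots> \<le> 18 / 2 ^ (k + n) * (1 / (1 - r))"
  proof (intro mult_left_mono)
    have "summable (\<lambda>m. r ^ m)" using r by (intro summable_geometric) auto
    then have "(\<Sum>m\<le>n. r ^ m) \<le> (\<Sum>m. r ^ m)" using r by (intro sum_le_suminf) auto
    then show "(\<Sum>m\<le>n. r ^ m) \<le> 1 / (1 - r)" using r by (simp add: suminf_geometric)
  qed simp
  finally show ?thesis by (simp add: r_def mult.commute)
qed

section \<open>Overlaps of projected squares, integrated over the slopes\<close>

text \<open>Let \<open>t\<close> be the denominator on the right. If \<open>t \<le> 4\<close>, the
  length of the whole window is small enough. If \<open>t \<le> 2 * M * \<bar>b\<bar>\<close>, the
  slopes lie in an interval of length \<open>4 / \<bar>b\<bar>\<close>. Otherwise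
  \<open>\<bar>a\<bar> = t\<close> and \<open>\<bar>x * b\<bar> < t / 2\<close>, so no slope
  qualifies.\<close>

lemma emeasure_slope_set_le:
  fixes a b M :: real
  assumes M: "1 \<le> M"
  shows "emeasure lborel ({-M..M} \<inter> {x. \<bar>a + x * b\<bar> \<le> 2}) \<le> ennreal (8 * M / max 1 (max \<bar>a\<bar> \<bar>b\<bar>))"
proof -
  define t where "t = max 1 (max \<bar>a\<bar> \<bar>b\<bar>)"
  have t: "1 \<le> t" "\<bar>a\<bar> \<le> t" "\<bar>b\<bar> \<le> t" "t = 1 \<or> t = \<bar>a\<bar> \<or> t = \<bar>b\<bar>" by (auto simp: t_def)
  let ?S = "{-M..M} \<inter> {x. \<bar>a + x * b\<bar> \<le> 2}"
  have "emeasure lborel ?S \<le> ennreal (8 * M / t)"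
  proof (cases "t \<le> 4")
    case True
    have "emeasure lborel ?S \<le> emeasure lborel {-M..M}" by (intro emeasure_mono) auto
    also have "\<dots> = ennreal (2 * M)" using M by simp
    also have "\<dots> \<le> ennreal (8 * M / t)"
      using True M t by (intro ennreal_leI) (simp add: field_simps)
    finally show ?thesis .
  next
    case t4: False
    show ?thesis
    proof (cases "t \<le> 2 * M * \<bar>b\<bar>")
      case True
      then have "b \<noteq> 0" using t4 by auto
      have "\<bar>x - (- a / b)\<bar> \<le> 2 / \<bar>b\<bar>" if "x \<in> ?S" for x
      proof -
        have "\<bar>a + x * b\<bar> = \<bar>x - (- a / b)\<bar> * \<bar>b\<bar>"
          using \<open>b \<noteq> 0\<close> by (simp add: field_simps flip: abs_mult)
        then show ?thesis using that \<open>b \<noteq> 0\<close> by (simp add: field_simps)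
      qed
      then have "?S \<subseteq> {- a / b - 2 / \<bar>b\<bar> .. - a / b + 2 / \<bar>b\<bar>}" by (fastforce simp: abs_le_iff)
      then have "emeasure lborel ?S \<le> emeasure lborel {- a / b - 2 / \<bar>b\<bar> .. - a / b + 2 / \<bar>b\<bar>}"
        by (intro emeasure_mono) auto
      also have "\<dots> = ennreal (4 / \<bar>b\<bar>)" by simp
      also have "\<dots> \<le> ennreal (8 * M / t)"
        using True \<open>b \<noteq> 0\<close> t by (intro ennreal_leI) (simp add: field_simps)
      finally show ?thesis .
    next
      case False
      have "\<bar>a + x * b\<bar> > 2" if "x \<in> {-M..M}" for x
      proof -
        have "1 * \<bar>b\<bar> \<le> M * \<bar>b\<bar>" using M by (intro mult_right_mono) auto
        then have "\<bar>a\<bar> = t" using t False t4 by linarith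
        moreover have "\<bar>x * b\<bar> \<le> M * \<bar>b\<bar>"
          using that unfolding abs_mult by (intro mult_right_mono) auto
        ultimately show ?thesis using False t4 by linarith
      qed
      then have "?S = {}" by fastforce
      then show ?thesis by simp
    qed
  qed
  then show ?thesis by (simp add: t_def)
qed

text \<open>
  Each pair \<open>q\<close> in \<open>S\<close> stands for the dyadic square of side \<open>\<delta>\<close> with lower left corner \<open>\<delta> q\<close>; its image under
  \<open>(a, b) \<mapsto> a + x b\<close> is replaced by the ball of radius \<open>\<delta>\<close> about the image of the corner. Two such balls
  meet iff the condition below holds, and then in a set of measure at most \<open>2 \<delta>\<close>, so that the sum bounds
  the squared L2 norm of the projected density.
\<close>

definition overlap_energy :: "(nat \<times> nat) set \<Rightarrow> (nat \<times> nat \<Rightarrow> real) \<Rightarrow> real \<Rightarrow> real \<Rightarrow> real" where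
  "overlap_energy S w \<delta> x = (\<Sum>p\<in>S. \<Sum>q\<in>S. w p * w q * (2 / \<delta>) *
     of_bool (\<bar>(real (fst p) - real (fst q)) + x * (real (snd p) - real (snd q))\<bar> \<le> 2))"

lemma borel_measurable_overlap_energy [measurable]: "overlap_energy S w \<delta> \<in> borel_measurable borel"
  unfolding overlap_energy_def[abs_def] of_bool_def by measurable

text \<open>Integrate term by term: a pair overlaps for a set of slopes of measure at most
  \<open>8 * M / block_dist p q\<close>. The prefactor \<open>2 / \<delta>\<close> turns 8 into 16,
  and its \<open>\<delta>\<close> cancels against the one in the bound by
  \<open>E * \<delta>\<close>.\<close>

lemma nn_integral_overlap_energy_le:
  assumes "1 \<le> M" "finite S" and w: "\<And>q. 0 \<le> w q" and "0 < \<delta>"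
    and E: "\<And>p. p \<in> S \<Longrightarrow> (\<Sum>q\<in>S. w q / block_dist p q) \<le> E * \<delta>"
    and "sum w S \<le> 1" "0 \<le> E"
  shows "(\<integral>\<^sup>+x\<in>{-M..M}. ennreal (overlap_energy S w \<delta> x) \<partial>lborel) \<le> ennreal (16 * M * E)"
proof -
  define T where "T = (\<lambda>p q. {x::real. \<bar>(real (fst p) - real (fst q)) + x * (real (snd p) - real (snd q))\<bar> \<le> 2})"
  have T [measurable]: "T p q \<in> sets borel" for p q unfolding T_def by measurable
  have "(\<integral>\<^sup>+x\<in>{-M..M}. ennreal (overlap_energy S w \<delta> x) \<partial>lborel)
    = (\<integral>\<^sup>+x. (\<Sum>p\<in>S. \<Sum>q\<in>S. ennreal (w p * w q * (2 / \<delta>)) * indicator ({-M..M} \<inter> T p q) x) \<partial>lborel)"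
  proof (rule nn_integral_cong)
    fix x
    have "ennreal (overlap_energy S w \<delta> x) = (\<Sum>p\<in>S. \<Sum>q\<in>S. ennreal (w p * w q * (2 / \<delta>)) * indicator (T p q) x)"
      unfolding overlap_energy_def T_def using w \<open>0 < \<delta>\<close>
      by (subst sum_ennreal[symmetric], force intro: sum_nonneg)
         (auto intro!: sum.cong simp: indicator_def simp flip: sum_ennreal)
    then show "ennreal (overlap_energy S w \<delta> x) * indicator {-M..M} x
      = (\<Sum>p\<in>S. \<Sum>q\<in>S. ennreal (w p * w q * (2 / \<delta>)) * indicator ({-M..M} \<inter> T p q) x)"
      by (auto simp: indicator_inter_arith split: split_indicator)
  qed
  also have "\<dots> = (\<Sum>p\<in>S. \<Sum>q\<in>S. ennreal (w p * w q * (2 / \<delta>)) * emeasure lborel ({-M..M} \<inter> T p q))"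
    by (subst nn_integral_sum, simp)+ (simp add: nn_integral_cmult_indicator)
  also have "\<dots> \<le> (\<Sum>p\<in>S. \<Sum>q\<in>S. ennreal (w p * w q * (2 / \<delta>)) * ennreal (8 * M / block_dist p q))"
    unfolding T_def block_dist_def using \<open>1 \<le> M\<close>
    by (intro sum_mono mult_left_mono emeasure_slope_set_le) auto
  also have "\<dots> = ennreal (\<Sum>p\<in>S. \<Sum>q\<in>S. w p * w q * (2 / \<delta>) * (8 * M / block_dist p q))"
  proof -
    have "0 \<le> w p * w q * (2 / \<delta>) * (8 * M / block_dist p q)" for p q
      using w \<open>0 < \<delta>\<close> \<open>1 \<le> M\<close> by (auto simp: block_dist_def intro!: mult_nonneg_nonneg divide_nonneg_nonneg)
    moreover have "0 \<le> w p * w q * (2 / \<delta>)" for p q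
      using w \<open>0 < \<delta>\<close> by auto
    ultimately show ?thesis
      by (simp add: sum_nonneg flip: ennreal_mult' sum_ennreal)
  qed
  also have "\<dots> = ennreal (16 * M / \<delta> * (\<Sum>p\<in>S. w p * (\<Sum>q\<in>S. w q / block_dist p q)))"
    by (simp add: sum_distrib_left mult_ac)
  also have "\<dots> \<le> ennreal (16 * M / \<delta> * (\<Sum>p\<in>S. w p * (E * \<delta>)))"
    using w E \<open>1 \<le> M\<close> \<open>0 < \<delta>\<close> by (intro ennreal_leI mult_left_mono sum_mono) auto
  also have "\<dots> = ennreal (16 * M * E * sum w S)"
    using \<open>0 < \<delta>\<close> unfolding sum_distrib_right[symmetric] by (simp add: mult_ac)
  also have "\<dots> \<le> ennreal (16 * M * E)"
    using assms by (intro ennreal_leI mult_left_le) auto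
  finally show ?thesis .
qed

section \<open>Positive measure for almost every slope\<close>

text \<open>Cauchy--Schwarz, in the form \<open>0 \<le> \<integral> (\<mu> 1\<^bsub>A\<^esub> - f)\<^sup>2\<close> with \<open>f\<close> the weighted
  sum of indicators of the balls and \<open>\<mu> = B / (2 c)\<close>.\<close>

lemma emeasure_Union_balls_ge:
  fixes w :: "nat \<times> nat \<Rightarrow> real" and x \<delta> :: real
  assumes "finite S" and w: "\<And>q. 0 \<le> w q" and \<delta>: "0 < \<delta>"
    and B: "overlap_energy S w \<delta> x \<le> B" "0 < B" and c: "0 < c" "c \<le> sum w S"
  shows "ennreal (4 * c\<^sup>2 / B) \<le> emeasure lborel (\<Union>q\<in>{q\<in>S. w q \<noteq> 0}. cball (\<delta> * (real (fst q) + x * real (snd q))) \<delta>)"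
proof -
  define J where "J = (\<lambda>q::nat\<times>nat. cball (\<delta> * (real (fst q) + x * real (snd q))) \<delta>)"
  define A where "A = (\<Union>q\<in>{q\<in>S. w q \<noteq> 0}. J q)"
  \<comment> \<open>Each ball has length \<open>2 * \<delta>\<close>, so the integral of
    \<open>f\<close> is \<open>2 * sum w S\<close>.\<close>
  define f where "f = (\<lambda>y. \<Sum>q\<in>S. w q / \<delta> * indicator (J q) y :: real)"
  define \<mu> where "\<mu> = B / (2 * c)"
  have "compact A" unfolding A_def J_def using \<open>finite S\<close> by (intro compact_UN) auto
  then have A: "A \<in> sets lborel" "emeasure lborel A < \<infinity>"
    using emeasure_compact_finite[of A] by (auto simp: borel_compact)
  have J: "J q \<in> sets lborel" "J p \<inter> J q \<in> sets lborel" for p q unfolding J_def by auto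
  have mJ: "measure lborel (J q) = 2 * \<delta>" "emeasure lborel (J q) < \<infinity>" for q
    unfolding J_def using \<delta> by (auto simp: cball_eq_atLeastAtMost)
  have mJJ: "emeasure lborel (J p \<inter> J q) < \<infinity>" for p q
    using mJ(2)[of p] emeasure_mono[of "J p \<inter> J q" "J p" lborel] J by (auto intro: le_less_trans)
  \<comment> \<open>\<open>f\<close> vanishes off \<open>A\<close>, because the balls left out of
    \<open>A\<close> have weight zero.\<close>
  have fA: "indicator A y * f y = f y" for y
  proof (cases "y \<in> A")
    case False
    have "w q / \<delta> * indicator (J q) y = 0" if "q \<in> S" for q
    proof -
      have "w q = 0 \<or> y \<notin> J q" using False that unfolding A_def by blast
      then show ?thesis by auto
    qed
    then have "f y = 0" unfolding f_def by (intro sum.neutral) auto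
    then show ?thesis by simp
  qed simp
  have sq: "(\<mu> * indicator A y - f y)\<^sup>2 = \<mu>\<^sup>2 * indicator A y - 2 * \<mu> * f y +
      (\<Sum>p\<in>S. \<Sum>q\<in>S. w p * w q / \<delta>\<^sup>2 * indicator (J p \<inter> J q) y)" for y
  proof -
    have "(f y)\<^sup>2 = (\<Sum>p\<in>S. \<Sum>q\<in>S. w p * w q / \<delta>\<^sup>2 * indicator (J p \<inter> J q) y)"
      unfolding f_def power2_eq_square sum_product by (simp add: indicator_inter_arith mult_ac)
    moreover have "(\<mu> * indicator A y - f y)\<^sup>2 = \<mu>\<^sup>2 * indicator A y - 2 * \<mu> * (indicator A y * f y) + (f y)\<^sup>2"
      by (simp add: power2_eq_square algebra_simps indicator_def)
    ultimately show ?thesis by (simp add: fA)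
  qed
  have iA: "integrable lborel (indicator A :: real \<Rightarrow> real)"
    using A by (intro integrable_real_indicator) auto
  have iJ: "integrable lborel (\<lambda>y. w q / \<delta> * indicator (J q) y)" for q
    using J mJ by (intro integrable_mult_right integrable_real_indicator) auto
  have iJJ: "integrable lborel (\<lambda>y. w p * w q / \<delta>\<^sup>2 * indicator (J p \<inter> J q) y)" for p q
    using J mJJ by (intro integrable_mult_right integrable_real_indicator) auto
  have If: "integrable lborel f" "integral\<^sup>L lborel f = 2 * sum w S"
    unfolding f_def using iJ J \<delta> by (auto simp: mJ simp flip: sum_distrib_right)
  have "0 \<le> (\<integral>y. (\<mu> * indicator A y - f y)\<^sup>2 \<partial>lborel)" by simp
  also have "\<dots> = \<mu>\<^sup>2 * measure lborel A - 2 * \<mu> * (2 * sum w S) +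
      (\<Sum>p\<in>S. \<Sum>q\<in>S. w p * w q / \<delta>\<^sup>2 * measure lborel (J p \<inter> J q))"
    unfolding sq using iA iJJ If A J by simp
  also have "(\<Sum>p\<in>S. \<Sum>q\<in>S. w p * w q / \<delta>\<^sup>2 * measure lborel (J p \<inter> J q)) \<le> overlap_energy S w \<delta> x"
    unfolding overlap_energy_def
  proof (intro sum_mono)
    fix p q
    let ?b = "of_bool (\<bar>real (fst p) - real (fst q) + x * (real (snd p) - real (snd q))\<bar> \<le> 2) :: real"
    have "measure lborel (J p \<inter> J q) \<le> 2 * \<delta> * ?b"
    proof (cases "J p \<inter> J q = {}")
      case False
      then obtain y where "dist (\<delta> * (real (fst p) + x * real (snd p))) y \<le> \<delta>"
        "dist (\<delta> * (real (fst q) + x * real (snd q))) y \<le> \<delta>" by (auto simp: J_def)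
      then have "\<bar>\<delta> * (real (fst p) + x * real (snd p)) - \<delta> * (real (fst q) + x * real (snd q))\<bar> \<le> \<delta> * 2"
        unfolding dist_real_def by linarith
      moreover have "\<delta> * (real (fst p) + x * real (snd p)) - \<delta> * (real (fst q) + x * real (snd q))
          = \<delta> * (real (fst p) - real (fst q) + x * (real (snd p) - real (snd q)))"
        by (simp add: algebra_simps)
      ultimately have "?b = 1"
        using \<delta> by (simp add: abs_mult)
      moreover have "measure lborel (J p \<inter> J q) \<le> measure lborel (J p)"
        using J mJ by (intro measure_mono_fmeasurable) (auto simp: fmeasurable_def)
      ultimately show ?thesis by (simp add: mJ)
    qed (use \<delta> in simp)
    then have "w p * w q / \<delta>\<^sup>2 * measure lborel (J p \<inter> J q) \<le> w p * w q / \<delta>\<^sup>2 * (2 * \<delta> * ?b)"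
      using w by (intro mult_left_mono) auto
    then show "w p * w q / \<delta>\<^sup>2 * measure lborel (J p \<inter> J q) \<le> w p * w q * (2 / \<delta>) * ?b"
      using \<delta> by (simp add: power2_eq_square)
  qed
  finally have main: "0 \<le> \<mu>\<^sup>2 * measure lborel A - 4 * \<mu> * sum w S + B"
    using B by simp
  have "0 < \<mu>" using B c by (simp add: \<mu>_def)
  \<comment> \<open>This \<open>\<mu>\<close> maximises the lower bound
    \<open>(4 * \<mu> * c - B) / \<mu>\<^sup>2\<close> for the measure of \<open>A\<close>.\<close>
  have "2 * B = 4 * \<mu> * c" using c by (simp add: \<mu>_def)
  also have "\<dots> \<le> 4 * \<mu> * sum w S" using c \<open>0 < \<mu>\<close> by simp
  finally have "B \<le> \<mu>\<^sup>2 * measure lborel A" using main by linarith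
  then have "B / \<mu>\<^sup>2 \<le> measure lborel A" using \<open>0 < \<mu>\<close> by (simp add: field_simps)
  moreover have "B / \<mu>\<^sup>2 = 4 * c\<^sup>2 / B" using B c by (simp add: \<mu>_def power2_eq_square field_simps)
  ultimately have "ennreal (4 * c\<^sup>2 / B) \<le> ennreal (measure lborel A)" by (simp add: ennreal_leI)
  also have "\<dots> = emeasure lborel A" using A by (intro emeasure_eq_ennreal_measure[symmetric]) auto
  finally show ?thesis by (simp add: A_def J_def)
qed

lemma hausdorff_measure_nonzeroE:
  assumes "hausdorff_measure s A \<noteq> 0"
  obtains \<delta> where "0 < \<delta>" "hausdorff_premeasure \<delta> s A \<noteq> 0"
proof -
  have "\<exists>\<delta>>0. hausdorff_premeasure \<delta> s A \<noteq> 0"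
  proof (rule ccontr)
    assume "\<not> (\<exists>\<delta>>0. hausdorff_premeasure \<delta> s A \<noteq> 0)"
    then have "hausdorff_measure s A \<le> 0"
      unfolding hausdorff_measure_def by (intro SUP_least) auto
    with assms show False by simp
  qed
  then show ?thesis using that by blast
qed

text \<open>\<open>i\<close> and \<open>c\<close> come from the premeasure of one piece of level
  \<open>k\<close>, hence do not depend on the depth \<open>n\<close>: the mass does not degenerate
  as the scale shrinks.\<close>

lemma frostman_weights:
  assumes K: "K \<subseteq> {0..1}" and s: "0 \<le> s" and pos: "hausdorff_premeasure \<delta> s K \<noteq> 0" and k: "1 / 2 ^ k \<le> \<delta>"
  obtains i c w where "0 < c" "\<And>n j. (0::real) \<le> w n j"
    "\<And>n j. w n j \<noteq> 0 \<Longrightarrow> dyadic_interval (k + n) j \<inter> K \<noteq> {}"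
    "\<And>n m l. m \<le> n \<Longrightarrow> sum (w n) (block m l) \<le> 2 powr (- s * real (k + n - m))"
    "\<And>n. c \<le> sum (w n) (block n i)"
proof -
  have "0 < 1 / (2::real) ^ k" by simp
  then have "0 \<le> \<delta>" using k by linarith
  then obtain i where i: "hausdorff_premeasure \<delta> s (K \<inter> dyadic_interval k i) \<noteq> 0"
    using dyadic_interval_positive_premeasure[OF K pos] by blast
  obtain w where w: "\<And>n j. 0 \<le> w n j"
    "\<And>n j. w n j \<noteq> 0 \<Longrightarrow> dyadic_interval (k + n) j \<inter> K \<noteq> {}"
    "\<And>n m l. m \<le> n \<Longrightarrow> sum (w n) (block m l) \<le> 2 powr (- s * real (k + n - m))"
    "\<And>n. hausdorff_premeasure \<delta> s (K \<inter> dyadic_interval k i) \<le> ennreal (sum (w n) (block n i))"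
    using discrete_frostman[OF s k, of _ i K] by metis
  \<comment> \<open>The total weight at depth 0 bounds this premeasure, which is therefore
    finite.\<close>
  obtain c where c: "hausdorff_premeasure \<delta> s (K \<inter> dyadic_interval k i) = ennreal c" "0 \<le> c"
    using w(4)[of 0] by (metis ennreal_cases ennreal_neq_top top_unique)
  have "0 < c" using c i by (cases "c = 0") auto
  moreover have "c \<le> sum (w n) (block n i)" for n
    using w(4)[of n] w(1) unfolding c by (subst (asm) ennreal_le_iff) (auto intro: sum_nonneg)
  ultimately show ?thesis using that w(1-3) by blast
qed

text \<open>Continuity from above: the closed neighbourhoods of radius
  \<open>1 / real (Suc n)\<close> decrease to \<open>P\<close> and, being compact, have finite
  measure.\<close>

lemma emeasure_compact_ge:
  fixes P :: "real set"
  assumes "compact P" "P \<noteq> {}" and \<eta>: "\<And>e. 0 < e \<Longrightarrow> \<eta> \<le> emeasure lborel {x. infdist x P \<le> e}"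
  shows "\<eta> \<le> emeasure lborel P"
proof -
  define V where "V = (\<lambda>n. {x. infdist x P \<le> 1 / real (Suc n)})"
  have V: "compact (V n)" for n
    unfolding V_def using assms by (intro compact_infdist_le) auto
  have "(\<Inter>n. V n) = P"
  proof (intro equalityI subsetI)
    fix x assume "x \<in> (\<Inter>n. V n)"
    then have *: "infdist x P \<le> 1 / real (Suc n)" for n by (auto simp: V_def)
    have "infdist x P \<le> 0"
    proof (rule field_le_epsilon)
      fix e :: real assume "0 < e"
      then obtain n where "inverse (real (Suc n)) < e" using reals_Archimedean by blast
      then show "infdist x P \<le> 0 + e" using *[of n] by (simp add: inverse_eq_divide)
    qed
    then have "infdist x P = 0" using infdist_nonneg[of x P] by linarith
    then show "x \<in> P"
      using in_closed_iff_infdist_zero[of P x] assms compact_imp_closed by blast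
  qed (auto simp: V_def)
  moreover have "(INF n. emeasure lborel (V n)) = emeasure lborel (\<Inter>n. V n)"
  proof (rule INF_emeasure_decseq)
    show "decseq V"
      unfolding V_def decseq_def
    proof (intro allI impI subsetI CollectI)
      fix m n :: nat and x assume "m \<le> n" "x \<in> {x. infdist x P \<le> 1 / real (Suc n)}"
      moreover have "1 / real (Suc n) \<le> 1 / real (Suc m)" using \<open>m \<le> n\<close> by (simp add: field_simps)
      ultimately show "infdist x P \<le> 1 / real (Suc m)" by simp
    qed
    show "emeasure lborel (V n) \<noteq> \<infinity>" for n
      using emeasure_compact_finite[OF V] by (auto simp: less_top)
  qed (use V borel_compact in auto)
  moreover have "\<eta> \<le> (INF n. emeasure lborel (V n))"
    unfolding V_def by (intro INF_greatest \<eta>) simp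
  ultimately show ?thesis by simp
qed

text \<open>The slopes stay in a bounded window because the energy estimate depends on
  \<open>M\<close>.\<close>

lemma AE_slope_projection_positive_bounded:
  fixes K1 K2 :: "real set"
  assumes K1: "compact K1" "K1 \<subseteq> {0..1}" and K2: "compact K2" "K2 \<subseteq> {0..1}"
    and st: "0 \<le> s" "0 \<le> t" "s + t > 1"
    and H: "hausdorff_measure s K1 \<noteq> 0" "hausdorff_measure t K2 \<noteq> 0"
    and M: "1 \<le> M"
  shows "AE x in lborel. x \<in> {-M..M} \<longrightarrow> emeasure lborel ((\<lambda>(a, b). a + x * b) ` (K1 \<times> K2)) \<noteq> 0"
proof -
  obtain \<delta>1 where d1: "0 < \<delta>1" "hausdorff_premeasure \<delta>1 s K1 \<noteq> 0"
    using hausdorff_measure_nonzeroE[OF H(1)] .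
  obtain \<delta>2 where d2: "0 < \<delta>2" "hausdorff_premeasure \<delta>2 t K2 \<noteq> 0"
    using hausdorff_measure_nonzeroE[OF H(2)] .
  \<comment> \<open>Both families of weights start at one common level, fine enough for
    \<open>\<delta>1\<close> and \<open>\<delta>2\<close>.\<close>
  obtain k where "(1 / 2) ^ k < min \<delta>1 \<delta>2"
    using real_arch_pow_inv[of "min \<delta>1 \<delta>2" "1 / 2"] d1 d2 by auto
  then have k: "1 / 2 ^ k \<le> \<delta>1" "1 / 2 ^ k \<le> \<delta>2" by (auto simp: power_one_over)
  obtain i c1 u where u: "0 < c1" "\<And>n j. (0::real) \<le> u n j"
    "\<And>n j. u n j \<noteq> 0 \<Longrightarrow> dyadic_interval (k + n) j \<inter> K1 \<noteq> {}"
    "\<And>n m l. m \<le> n \<Longrightarrow> sum (u n) (block m l) \<le> 2 powr (- s * real (k + n - m))"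
    "\<And>n. c1 \<le> sum (u n) (block n i)"
    using frostman_weights[OF K1(2) st(1) d1(2) k(1)] by metis
  obtain j c2 v where v: "0 < c2" "\<And>n j. (0::real) \<le> v n j"
    "\<And>n j. v n j \<noteq> 0 \<Longrightarrow> dyadic_interval (k + n) j \<inter> K2 \<noteq> {}"
    "\<And>n m l. m \<le> n \<Longrightarrow> sum (v n) (block m l) \<le> 2 powr (- t * real (k + n - m))"
    "\<And>n. c2 \<le> sum (v n) (block n j)"
    using frostman_weights[OF K2(2) st(2) d2(2) k(2)] by metis
  define S where "S = (\<lambda>n. block n i \<times> block n j)"
  define w where "w = (\<lambda>n q. u n (fst q) * v n (snd q))"
  define \<delta> where "\<delta> = (\<lambda>n. 1 / (2::real) ^ (k + n))"
  define E where "E = 18 / (1 - 2 powr (1 - s - t))"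
  define F where "F = (\<lambda>n. overlap_energy (S n) (w n) (\<delta> n))"
  define P where "P = (\<lambda>x. (\<lambda>(a, b). a + x * b) ` (K1 \<times> K2))"
  have \<delta>: "0 < \<delta> n" for n by (simp add: \<delta>_def)
  have S: "finite (S n)" for n by (simp add: S_def)
  have w: "0 \<le> w n q" for n q using u(2) v(2) by (simp add: w_def)
  have sum_w: "sum (w n) (S n) = sum (u n) (block n i) * sum (v n) (block n j)" for n
    unfolding w_def S_def by (rule sum_fst_times_snd)
  have "2 powr (1 - s - t) < 1" using st by (simp add: powr_less_one)
  then have E: "0 \<le> E" by (simp add: E_def)
  have F_meas [measurable]: "F n \<in> borel_measurable borel" for n
    unfolding F_def by measurable
  have int: "(\<integral>\<^sup>+x\<in>{-M..M}. ennreal (F n x) \<partial>lborel) \<le> ennreal (16 * M * E)" for n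
    unfolding F_def
  proof (rule nn_integral_overlap_energy_le[OF M S w \<delta> _ _ E])
    show "(\<Sum>q\<in>S n. w n q / block_dist p q) \<le> E * \<delta> n" if "p \<in> S n" for p
      using discrete_energy_le[of "u n" n s k "v n" t p i j] u v st that
      by (simp add: S_def w_def E_def \<delta>_def)
    \<comment> \<open>The Frostman bound on a full block, \<open>m = n\<close>, is at most 1 because
      the exponents are nonnegative.\<close>
    have "2 powr (- s * real (k + n - n)) \<le> 2 powr 0" "2 powr (- t * real (k + n - n)) \<le> 2 powr 0"
      using st by (intro powr_mono; simp)+
    then have "sum (u n) (block n i) \<le> 1" "sum (v n) (block n j) \<le> 1"
      using u(4)[of n n i] v(4)[of n n j] by auto
    moreover have "0 \<le> sum (v n) (block n j)" "0 \<le> sum (u n) (block n i)"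
      using u(2) v(2) by (auto intro: sum_nonneg)
    ultimately show "sum (w n) (S n) \<le> 1"
      unfolding sum_w by (intro mult_le_one) auto
  qed
  \<comment> \<open>Fatou: integrals bounded uniformly in \<open>n\<close> force a finite lower
    limit almost everywhere.\<close>
  have "AE x in lborel. liminf (\<lambda>n. ennreal (F n x) * indicator {-M..M} x) \<noteq> \<infinity>"
  proof (rule nn_integral_PInf_AE)
    have "(\<integral>\<^sup>+x. liminf (\<lambda>n. ennreal (F n x) * indicator {-M..M} x) \<partial>lborel)
        \<le> liminf (\<lambda>n. \<integral>\<^sup>+x\<in>{-M..M}. ennreal (F n x) \<partial>lborel)"
      by (rule nn_integral_liminf) measurable
    also have "\<dots> \<le> limsup (\<lambda>n. \<integral>\<^sup>+x\<in>{-M..M}. ennreal (F n x) \<partial>lborel)"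
      by (rule Liminf_le_Limsup) simp
    also have "\<dots> \<le> ennreal (16 * M * E)"
      using int by (intro Limsup_bounded) auto
    finally show "(\<integral>\<^sup>+x. liminf (\<lambda>n. ennreal (F n x) * indicator {-M..M} x) \<partial>lborel) \<noteq> \<infinity>"
      using ennreal_less_top by (auto simp: top_unique)
  qed measurable
  then show ?thesis
  proof eventually_elim
    case (elim x)
    show ?case
    proof
      assume x: "x \<in> {-M..M}"
      then have "liminf (\<lambda>n. ennreal (F n x)) \<noteq> \<infinity>" using elim by simp
      then obtain l where l: "liminf (\<lambda>n. ennreal (F n x)) = ennreal l" "0 \<le> l"
        by (metis ennreal_cases infinity_ennreal_def)
      \<comment> \<open>Were the energy above \<open>l + 1\<close> for all large \<open>n\<close>,
        its lower limit could not be \<open>l\<close>; so \<open>B\<close> bounds it at infinitely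
        many scales.\<close>
      define B where "B = l + 1"
      have "\<exists>\<^sub>F n in sequentially. F n x \<le> B"
      proof (rule ccontr)
        assume "\<not> ?thesis"
        then have "\<forall>\<^sub>F n in sequentially. ennreal B \<le> ennreal (F n x)"
          by (auto simp: not_frequently not_le elim!: eventually_mono intro!: ennreal_leI)
        then have "ennreal B \<le> ennreal l" unfolding l(1)[symmetric] by (rule Liminf_bounded)
        then show False using l(2) by (simp add: B_def ennreal_le_iff)
      qed
      note freq = this
      have B: "0 < B" using l by (simp add: B_def)
      define c where "c = c1 * c2"
      have c: "0 < c" "c \<le> sum (w n) (S n)" for n
      proof -
        show "0 < c" using u(1) v(1) by (simp add: c_def)
        show "c \<le> sum (w n) (S n)"
          unfolding c_def sum_w using u(1,2) v(1) u(5)[of n] v(5)[of n]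
          by (intro mult_mono) (auto intro: sum_nonneg)
      qed
      \<comment> \<open>A nonzero weight at depth 0 sits on dyadic intervals that meet both Cantor
        sets.\<close>
      have ne: "P x \<noteq> {}"
      proof -
        have "sum (w 0) (S 0) \<noteq> 0" using c(1) c(2)[of 0] by linarith
        then obtain q where "w 0 q \<noteq> 0" by (rule sum.not_neutral_contains_not_neutral)
        then have "u 0 (fst q) \<noteq> 0" "v 0 (snd q) \<noteq> 0" by (auto simp: w_def)
        then have "K1 \<noteq> {}" "K2 \<noteq> {}" using u(3) v(3) by blast+
        then show ?thesis by (auto simp: P_def)
      qed
      have cpt: "compact (P x)"
        unfolding P_def case_prod_beta using K1 K2
        by (intro compact_continuous_image continuous_intros compact_Times)
      have ge: "ennreal (4 * c\<^sup>2 / B) \<le> emeasure lborel {y. infdist y (P x) \<le> e}" if e: "0 < e" for e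
      proof -
        \<comment> \<open>The error \<open>(2 + M) * \<delta> n\<close> is eventually below
          \<open>e\<close>, while the energy bound holds infinitely often, so some \<open>n\<close>
          satisfies both.\<close>
        have "(\<lambda>n. (2 + M) * (1 / 2) ^ k * (1 / 2) ^ n) \<longlonglongrightarrow> (2 + M) * (1 / 2) ^ k * 0"
          by (intro tendsto_intros LIMSEQ_power_zero) simp
        then have "\<forall>\<^sub>F n in sequentially. (2 + M) * (1 / 2) ^ k * (1 / 2) ^ n < e"
          using e by (auto dest: order_tendstoD)
        then have "\<forall>\<^sub>F n in sequentially. (2 + M) * \<delta> n < e"
          by (simp add: \<delta>_def power_add power_one_over)
        with freq have "\<exists>\<^sub>F n in sequentially. F n x \<le> B \<and> (2 + M) * \<delta> n < e"
          by (rule frequently_eventually_frequently)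
        then obtain n where n: "F n x \<le> B" "(2 + M) * \<delta> n < e" by (auto dest: frequently_ex)
        have "ennreal (4 * c\<^sup>2 / B) \<le> emeasure lborel (\<Union>q\<in>{q\<in>S n. w n q \<noteq> 0}. cball (\<delta> n * (real (fst q) + x * real (snd q))) (\<delta> n))"
          using n(1) unfolding F_def by (intro emeasure_Union_balls_ge S w \<delta> B c)
        also have "\<dots> \<le> emeasure lborel {y. infdist y (P x) \<le> e}"
        proof (rule emeasure_mono)
          show "(\<Union>q\<in>{q\<in>S n. w n q \<noteq> 0}. cball (\<delta> n * (real (fst q) + x * real (snd q))) (\<delta> n)) \<subseteq> {y. infdist y (P x) \<le> e}"
          proof clarsimp
            fix p q y
            assume *: "w n (p, q) \<noteq> 0" "dist (\<delta> n * (real p + x * real q)) y \<le> \<delta> n"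
            then have "u n p \<noteq> 0" "v n q \<noteq> 0" by (auto simp: w_def)
            then obtain a b where a: "a \<in> K1" "a \<in> dyadic_interval (k + n) p" and b: "b \<in> K2" "b \<in> dyadic_interval (k + n) q"
              using u(3) v(3) by blast
            have a': "\<bar>a - \<delta> n * p\<bar> \<le> \<delta> n" and b': "\<bar>b - \<delta> n * q\<bar> \<le> \<delta> n"
              using a(2) b(2) by (auto simp: dyadic_interval_def \<delta>_def add_divide_distrib abs_le_iff)
            \<comment> \<open>The error splits into \<open>\<delta> n\<close> for the radius of the
              ball, \<open>\<delta> n\<close> for moving the corner to \<open>a\<close>, and
              \<open>M * \<delta> n\<close> for moving it to \<open>b\<close>.\<close>
            have "\<bar>x * (b - \<delta> n * q)\<bar> \<le> M * \<delta> n"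
              unfolding abs_mult using x M b' by (intro mult_mono) auto
            moreover have "y - (a + x * b) = (y - \<delta> n * (real p + x * real q)) - (a - \<delta> n * p) - x * (b - \<delta> n * q)"
              by (simp add: algebra_simps)
            ultimately have "dist y (a + x * b) \<le> (2 + M) * \<delta> n"
              using a' *(2) unfolding dist_real_def by (simp add: distrib_right)
            moreover have "a + x * b \<in> P x" unfolding P_def using a b by force
            ultimately show "infdist y (P x) \<le> e" using n(2) infdist_le[of "a + x * b" "P x" y] by linarith
          qed
        qed (auto intro!: borel_closed closed_Collect_le continuous_intros)
        finally show ?thesis .
      qed
      have "ennreal (4 * c\<^sup>2 / B) \<le> emeasure lborel (P x)"
        using cpt ne ge by (rule emeasure_compact_ge)
      moreover have "0 < 4 * c\<^sup>2 / B" using B c by simp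
      ultimately show "emeasure lborel ((\<lambda>(a, b). a + x * b) ` (K1 \<times> K2)) \<noteq> 0"
        unfolding P_def by (auto simp: ennreal_eq_0_iff not_le[symmetric])
    qed
  qed
qed

section \<open>From slopes to angles\<close>

text \<open>Countably many bounded windows exhaust all slopes.\<close>

lemma AE_slope_projection_positive:
  fixes K1 K2 :: "real set"
  assumes "compact K1" "K1 \<subseteq> {0..1}" "compact K2" "K2 \<subseteq> {0..1}"
    and "0 \<le> s" "0 \<le> t" "s + t > 1"
    and "hausdorff_measure s K1 \<noteq> 0" "hausdorff_measure t K2 \<noteq> 0"
  shows "AE x in lborel. emeasure lborel ((\<lambda>(a, b). a + x * b) ` (K1 \<times> K2)) \<noteq> 0"
proof -
  have "AE x in lborel. \<forall>n. x \<in> {- real (Suc n)..real (Suc n)} \<longrightarrow>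
      emeasure lborel ((\<lambda>(a, b). a + x * b) ` (K1 \<times> K2)) \<noteq> 0"
    unfolding AE_all_countable using assms by (intro allI AE_slope_projection_positive_bounded) auto
  then show ?thesis
  proof eventually_elim
    case (elim x)
    obtain n where "\<bar>x\<bar> \<le> real n" using real_arch_simple by blast
    then have "x \<in> {- real (Suc n)..real (Suc n)}" by auto
    with elim show ?case by blast
  qed
qed

text \<open>The coordinate of \<open>(a, b)\<close> along \<open>dir_vec \<theta>\<close> is
  \<open>cos \<theta> * (a + tan \<theta> * b)\<close>, a scaled projection of slope
  \<open>tan \<theta>\<close>.\<close>

lemma line_measure_proj:
  assumes "cos \<theta> \<noteq> 0"
  shows "line_measure \<theta> (proj \<theta> ` (A \<times> B)) =
    ennreal \<bar>cos \<theta>\<bar> * emeasure lebesgue ((\<lambda>(a, b). a + tan \<theta> * b) ` (A \<times> B))"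
proof -
  have nz: "dir_vec \<theta> \<noteq> 0" by (metis norm_dir_vec norm_zero zero_neq_one)
  have "{t. t *\<^sub>R dir_vec \<theta> \<in> proj \<theta> ` (A \<times> B)} = (\<lambda>p. p \<bullet> dir_vec \<theta>) ` (A \<times> B)"
    using nz by (auto simp: proj_def)
  also have "\<dots> = (\<lambda>x. cos \<theta> *\<^sub>R x + 0) ` (\<lambda>(a, b). a + tan \<theta> * b) ` (A \<times> B)"
    unfolding image_image using assms
    by (intro image_cong) (auto simp: dir_vec_def tan_def field_simps)
  finally have "{t. t *\<^sub>R dir_vec \<theta> \<in> proj \<theta> ` (A \<times> B)} =
    (\<lambda>x. cos \<theta> *\<^sub>R x + 0) ` (\<lambda>(a, b). a + tan \<theta> * b) ` (A \<times> B)" .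
  then show ?thesis
    unfolding line_measure_def by (simp only: emeasure_lebesgue_affine DIM_real power_one_right)
qed

text \<open>Where the cosine is nonzero, \<open>\<theta>\<close> differs from
  \<open>arctan (tan \<theta>)\<close> by a multiple of \<open>pi\<close>, and the differentiable
  function \<open>arctan\<close> maps null sets to null sets. The zeros of the cosine are
  countable.\<close>

lemma negligible_tan_vimage:
  fixes N :: "real set"
  assumes "negligible N"
  shows "negligible {\<theta>. cos \<theta> = 0 \<or> tan \<theta> \<in> N}"
proof (rule negligible_subset)
  have "arctan differentiable_on N"
    unfolding differentiable_on_def real_differentiable_def
    using DERIV_arctan has_field_derivative_at_within by blast
  then have "negligible (arctan ` N)"
    using assms by (intro negligible_differentiable_image_negligible) auto
  then have "negligible ((+) (of_int z * pi) ` arctan ` N)" for z :: int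
    by (rule negligible_translation)
  then have "negligible (\<Union>z::int. (+) (of_int z * pi) ` arctan ` N)"
    by (intro negligible_countable_Union countable_image) auto
  moreover have "negligible (range (\<lambda>z::int. of_int z * (pi / 2)))"
    unfolding negligible_iff_null_sets
    by (intro null_sets_completionI countable_imp_null_set_lborel) simp
  ultimately show "negligible ((\<Union>z::int. (+) (of_int z * pi) ` arctan ` N) \<union> range (\<lambda>z::int. of_int z * (pi / 2)))"
    by (rule negligible_Un)
  show "{\<theta>. cos \<theta> = 0 \<or> tan \<theta> \<in> N} \<subseteq> (\<Union>z::int. (+) (of_int z * pi) ` arctan ` N) \<union> range (\<lambda>z::int. of_int z * (pi / 2))"
  proof
    fix \<theta> assume \<theta>: "\<theta> \<in> {\<theta>. cos \<theta> = 0 \<or> tan \<theta> \<in> N}"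
    show "\<theta> \<in> (\<Union>z::int. (+) (of_int z * pi) ` arctan ` N) \<union> range (\<lambda>z::int. of_int z * (pi / 2))"
    proof (cases "cos \<theta> = 0")
      case True
      then show ?thesis by (auto simp: cos_zero_iff_int)
    next
      case False
      define \<phi> where "\<phi> = arctan (tan \<theta>)"
      have "cos \<phi> \<noteq> 0" "tan \<phi> = tan \<theta>" by (simp_all add: \<phi>_def tan_arctan)
      then have "sin (\<theta> - \<phi>) = 0"
        using False by (simp add: sin_diff tan_def field_simps)
      then obtain z :: int where "\<theta> - \<phi> = of_int z * pi" by (auto simp: sin_zero_iff_int2)
      then have "\<theta> = of_int z * pi + arctan (tan \<theta>)" by (simp add: \<phi>_def)
      then show ?thesis using \<theta> False by blast
    qed
  qed
qed

section \<open>Compactness of regular Cantor sets\<close>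

lemma class_C1plus_continuous_on:
  assumes "class_C1plus \<alpha> f U" "0 < \<alpha>" "open U"
  shows "continuous_on U f"
proof -
  have "0 < nat \<lceil>\<alpha>\<rceil>" using assms(2) by simp
  then obtain D where D: "\<And>x. x \<in> U \<Longrightarrow> D 0 x = f x"
    "\<And>x. x \<in> U \<Longrightarrow> (D 0 has_real_derivative D (Suc 0) x) (at x)"
    using assms(1) unfolding class_C1plus_def Let_def by blast
  have "continuous_on U (D 0)"
    using D(2) by (meson DERIV_isCont continuous_at_imp_continuous_on)
  then show ?thesis using D(1) continuous_on_cong by metis
qed

text \<open>As \<open>f\<close> is assumed continuous only on \<open>C\<close>, an iterate is
  controlled only where the earlier iterates stay in \<open>C\<close>; closedness of these sets and
  continuity on them go through one joint induction.\<close>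

lemma closed_invariant_set:
  fixes f :: "'a::t2_space \<Rightarrow> 'a"
  assumes "closed C" "continuous_on C f"
  shows "closed {x. \<forall>n. (f ^^ n) x \<in> C}"
proof -
  define T where "T = (\<lambda>n. {x. \<forall>m\<le>n. (f ^^ m) x \<in> C})"
  have "closed (T n) \<and> continuous_on (T n) (f ^^ n)" for n
  proof (induction n)
    case 0
    then show ?case using assms by (simp add: T_def id_def)
  next
    case (Suc n)
    have "continuous_on (T n) (f \<circ> (f ^^ n))"
      using Suc assms(2) by (intro continuous_on_compose continuous_on_subset[OF assms(2)]) (auto simp: T_def)
    then have *: "continuous_on (T n) (f ^^ Suc n)" by (simp add: o_def)
    have "T (Suc n) = T n \<inter> (f ^^ Suc n) -` C"
      by (auto simp: T_def le_Suc_eq)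
    moreover have "closed (T n \<inter> (f ^^ Suc n) -` C)"
      using * Suc assms(1) by (intro continuous_closed_preimage) auto
    ultimately show ?case using * by (auto intro: continuous_on_subset)
  qed
  moreover have "{x. \<forall>n. (f ^^ n) x \<in> C} = (\<Inter>n. T n)"
    by (auto simp: T_def)
  ultimately show ?thesis by auto
qed

lemma regular_Cantor_set_compact:
  assumes "regular_Cantor_set \<alpha> K" "0 < \<alpha>"
  shows "compact K" "K \<subseteq> {0..1}" "K \<noteq> {}"
proof -
  obtain r :: nat and a b U \<psi> where r: "1 \<le> r"
    and I: "\<And>i. i \<in> {1..r} \<Longrightarrow> a i < b i \<and> {a i..b i} \<subseteq> {0..1::real}"
    and sub: "K \<subseteq> (\<Union>i\<in>{1..r}. {a i..b i})"
    and fr: "\<And>i. i \<in> {1..r} \<Longrightarrow> frontier {a i..b i} \<subseteq> K"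
    and U: "open U" "(\<Union>i\<in>{1..r}. {a i..b i}) \<subseteq> U" "class_C1plus \<alpha> \<psi> U"
    and K: "K = {x. \<forall>n. (\<psi> ^^ n) x \<in> (\<Union>i\<in>{1..r}. {a i..b i})}"
    using assms(1) unfolding regular_Cantor_set_def Let_def
    by (elim exE conjE) (rule that, assumption, erule (1) bspec, assumption, erule (1) bspec, assumption+)
  show "K \<subseteq> {0..1}" using sub I by blast
  have "continuous_on (\<Union>i\<in>{1..r}. {a i..b i}) \<psi>"
    using class_C1plus_continuous_on[OF U(3) assms(2) U(1)] U(2) by (rule continuous_on_subset)
  then have "closed K" unfolding K by (intro closed_invariant_set) auto
  then show "compact K" using \<open>K \<subseteq> {0..1}\<close>
    by (meson bounded_closed_interval bounded_subset compact_eq_bounded_closed)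
  \<comment> \<open>The endpoints of the first interval belong to \<open>K\<close>.\<close>
  show "K \<noteq> {}" using r I[of 1] fr[of 1] by (auto simp: frontier_def interior_atLeastAtMost_real)
qed

theorem theorem1p1:
  fixes \<alpha> :: real and K1 K2 :: "real set"
  assumes "\<alpha> > 0"
    and "regular_Cantor_set \<alpha> K1"
    and "regular_Cantor_set \<alpha> K2"
    and "HD K1 + HD K2 > 1"
  shows "AE \<theta> in lebesgue. line_measure \<theta> (proj \<theta> ` (K1 \<times> K2)) > 0"
proof -
  note K1 = regular_Cantor_set_compact[OF assms(2,1)]
  note K2 = regular_Cantor_set_compact[OF assms(3,1)]
  obtain s t where "0 \<le> s" "0 \<le> t" "s + t > 1"
    "hausdorff_measure s K1 \<noteq> 0" "hausdorff_measure t K2 \<noteq> 0"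
    using exponents_below_HD[OF K1(3) K2(3) assms(4)] .
  then have AE: "AE x in lborel. emeasure lborel ((\<lambda>(a, b). a + x * b) ` (K1 \<times> K2)) \<noteq> 0"
    using K1 K2 by (intro AE_slope_projection_positive)
  define N where "N = {x. emeasure lborel ((\<lambda>(a, b). a + x * b) ` (K1 \<times> K2)) = 0}"
  \<comment> \<open>Measurability of \<open>N\<close> is not established; enclosing it in a null set
    gives negligibility.\<close>
  obtain N' where "N' \<in> null_sets lborel" "N \<subseteq> N'"
    using AE by (auto simp: eventually_ae_filter N_def)
  then have "negligible N"
    by (meson negligible_iff_null_sets negligible_subset null_sets_completionI)
  then have "negligible {\<theta>. cos \<theta> = 0 \<or> tan \<theta> \<in> N}" by (rule negligible_tan_vimage)
  then have "AE \<theta> in lebesgue. \<theta> \<notin> {\<theta>. cos \<theta> = 0 \<or> tan \<theta> \<in> N}"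
    unfolding negligible_iff_null_sets by (rule AE_not_in)
  then show ?thesis
  proof eventually_elim
    case (elim \<theta>)
    then have \<theta>: "cos \<theta> \<noteq> 0" and pos: "emeasure lborel ((\<lambda>(a, b). a + tan \<theta> * b) ` (K1 \<times> K2)) \<noteq> 0"
      by (auto simp: N_def)
    \<comment> \<open>A compact image is Borel, so \<open>lborel\<close> and \<open>lebesgue\<close>
      agree on it.\<close>
    have "compact ((\<lambda>(a, b). a + tan \<theta> * b) ` (K1 \<times> K2))"
      unfolding case_prod_beta using K1 K2
      by (intro compact_continuous_image continuous_intros compact_Times)
    then have "emeasure lebesgue ((\<lambda>(a, b). a + tan \<theta> * b) ` (K1 \<times> K2)) \<noteq> 0"
      using pos by (simp add: borel_compact)
    then show ?case
      unfolding line_measure_proj[OF \<theta>] using \<theta> by (simp add: ennreal_zero_less_mult_iff zero_less_iff_neq_zero)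
  qed
qed

end
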